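(* Let $q\in\mathbb{C}$ with $|q|<1$. Then $$1+\sum_{n=1}^\infty \frac{q^{n^2}(-q^3;q^3)_{n-1}}{(-q;q)_n(q;q)_{2n-1}} = \frac{(q^{12},q^{15},q^{27};q^{27})_\infty-2q^2(-q^{33},-q^{75},q^{108};q^{108})_\infty+2q^{7}(-q^{15},-q^{93},q^{108};q^{108})_\infty}{(q;q)_\infty}.$$
   Context: For $|q|<1$, $x\in\mathbb{C}$ and an integer $n\ge 0$: $(x;q)_n=\prod_{j=0}^{n-1}(1-xq^j)$ (so $(x;q)_0=1$), $(x;q)_\infty=\prod_{j=0}^{\infty}(1-xq^j)$, and $(x_1,\dots,x_k;q)_\infty=\prod_{i=1}^k (x_i;q)_\infty$. The same notation is used with base $q^m$ in place of $q$. *)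

theory Defs
  imports "HOL-Analysis.Analysis"
begin

definition qpoch :: "complex \<Rightarrow> complex \<Rightarrow> nat \<Rightarrow> complex" where
  "qpoch x q n = (\<Prod>j<n. 1 - x * q ^ j)"

definition qpoch_inf :: "complex \<Rightarrow> complex \<Rightarrow> complex" where
  "qpoch_inf x q = (\<Prod>j. 1 - x * q ^ j)"

definition qpoch_inf_list :: "complex list \<Rightarrow> complex \<Rightarrow> complex" where
  "qpoch_inf_list xs q = (\<Prod>x\<leftarrow>xs. qpoch_inf x q)"

text \<open>For a base of norm less than 1 the infinite product converges for every x, also when one of
  its factors vanishes, so the value of \<^const>\<open>qpoch_inf\<close> is the intended one.\<close>

lemma has_prod_qpoch_inf:
  assumes "norm q < 1"
  shows "(\<lambda>j. 1 - x * q ^ j) has_prod qpoch_inf x q"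
proof -
  have "summable (\<lambda>j. norm x * norm q ^ j)"
    using assms by (intro summable_mult summable_geometric) simp
  then have "summable (\<lambda>j. norm ((1 - x * q ^ j) - 1))"
    by (simp add: norm_mult norm_power)
  then have "abs_convergent_prod (\<lambda>j. 1 - x * q ^ j)"
    by (rule summable_imp_abs_convergent_prod)
  then have "convergent_prod (\<lambda>j. 1 - x * q ^ j)"
    by (rule abs_convergent_prod_imp_convergent_prod)
  then show ?thesis
    unfolding qpoch_inf_def by (rule convergent_prod_has_prod)
qed

end

theory Submission
  imports Defs
begin

text \<open>Since \<open>1 + q ^ (3 * j) = (1 + q ^ j) * (1 - x * q ^ j) * (1 - q ^ j / x)\<close> for a primitive sixth
  root of unity \<open>x\<close>, the \<open>n\<close>-th summand without \<open>q ^ (n ^ 2)\<close> is a multiple of the difference of the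
  finite Jacobi triple products at \<open>1 / x\<close> and \<open>x\<close>. This makes it the \<open>\<beta>\<close>-side of a Bailey pair relative
  to 1 (up to the value at \<open>n = 0\<close>) with \<open>\<alpha>\<close>-side \<open>\<chi>(r) * q ^ (r * (r - 1) / 2)\<close>, \<open>\<chi>\<close> the nontrivial
  character modulo 3. Bailey's lemma turns the series into the sum of \<open>\<chi>(r) * q ^ (r * (3 * r - 1) / 2)\<close>
  over all integers \<open>r\<close>, divided by \<open>qpoch_inf q q\<close>. The summand 1 contributes the pentagonal series, with
  sign \<open>(-1) ^ r\<close> in place of \<open>\<chi>(r)\<close>. The combined coefficient \<open>(-1) ^ r + \<chi>(r)\<close> vanishes for \<open>r\<close>
  congruent to 1 or 2 modulo 6, and the residue classes 0 modulo 3, 5 and 4 modulo 6 give the three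
  theta products.\<close>

section \<open>Dominated convergence for sums over the integers\<close>

text \<open>Enumerating the integers by \<open>int_decode\<close> reduces this to Tannery's theorem
  for series over the naturals. It carries the bilateral limits in the triple product and in
  Bailey's lemma.\<close>

lemma has_sum_int_tannery:
  fixes f :: "int \<Rightarrow> nat \<Rightarrow> complex"
  assumes lim: "\<And>r. (\<lambda>N. f r N) \<longlonglongrightarrow> g r"
    and bound: "\<And>r N. norm (f r N) \<le> M r"
    and M: "M summable_on UNIV"
    and sums: "\<And>N. ((\<lambda>r. f r N) has_sum s N) UNIV"
    and s: "s \<longlonglongrightarrow> S"
  shows "(g has_sum S) UNIV"
proof -
  have *: "(h has_sum x) UNIV \<longleftrightarrow> ((\<lambda>n. h (int_decode n)) has_sum x) UNIV" for h :: "int \<Rightarrow> complex" and x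
    using has_sum_reindex_bij_betw[OF bij_int_decode] by metis
  have "(\<lambda>n. M (int_decode n)) summable_on UNIV"
    using summable_on_reindex_bij_betw[OF bij_int_decode, of M] M by simp
  then have M': "summable (\<lambda>n. M (int_decode n))"
    by (rule summable_on_imp_summable)
  have T: "summable (\<lambda>n. norm (g (int_decode n)))"
    "(\<lambda>N. \<Sum>n. f (int_decode n) N) \<longlonglongrightarrow> (\<Sum>n. g (int_decode n))"
    using tannerys_theorem[of "\<lambda>n N. f (int_decode n) N" "\<lambda>n. g (int_decode n)" sequentially
        "\<lambda>n. M (int_decode n)", OF lim _ M'] bound by (auto simp: always_eventually)
  have "(\<Sum>n. f (int_decode n) N) = s N" for N
    using sums[of N] by (subst (asm) *) (metis has_sum_imp_sums sums_unique)
  with T(2) s have "(\<Sum>n. g (int_decode n)) = S"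
    using LIMSEQ_unique by simp
  then show ?thesis
    using T(1) by (subst *) (metis norm_summable_imp_has_sum summable_norm_cancel summable_sums)
qed

lemma has_sum_int_single:
  fixes f :: "int \<Rightarrow> complex"
  assumes "\<And>r. r \<noteq> k \<Longrightarrow> f r = 0"
  shows "(f has_sum f k) UNIV"
proof -
  have "(f has_sum f k) {k}" using has_sum_finite[of "{k}" f] by simp
  then show ?thesis using has_sum_cong_neutral[of UNIV "{k}" f f "f k"] assms by auto
qed

lemma has_sum_int_shift:
  fixes f :: "int \<Rightarrow> complex"
  shows "((\<lambda>r. f (r + k)) has_sum S) UNIV \<longleftrightarrow> (f has_sum S) UNIV"
  by (rule has_sum_reindex_bij_witness[of _ "\<lambda>r. r - k" "\<lambda>r. r + k"]) auto

lemma has_sum_finite_sum: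
  fixes f :: "'i \<Rightarrow> 'a \<Rightarrow> complex"
  assumes "finite I" "\<And>i. i \<in> I \<Longrightarrow> (f i has_sum s i) A"
  shows "((\<lambda>x. \<Sum>i\<in>I. f i x) has_sum (\<Sum>i\<in>I. s i)) A"
  using assms by (induction I rule: finite_induct) (auto intro!: has_sum_add)

section \<open>Limits of finite q-Pochhammer symbols\<close>

lemma qpoch_0 [simp]: "qpoch x q 0 = 1"
  by (simp add: qpoch_def)

lemma qpoch_Suc: "qpoch x q (Suc n) = qpoch x q n * (1 - x * q ^ n)"
  by (simp add: qpoch_def)

lemma qpoch_Suc_left: "qpoch x q (Suc n) = (1 - x) * qpoch (x * q) q n"
  by (simp add: qpoch_def prod.lessThan_Suc_shift mult.assoc del: prod.lessThan_Suc)

lemma qpoch_nonzero: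
  assumes "norm q < 1" "norm x < 1"
  shows "qpoch x q n \<noteq> 0"
proof -
  have "x * q ^ j \<noteq> 1" for j
  proof
    assume "x * q ^ j = 1"
    then have "norm x * norm q ^ j = 1" by (metis norm_mult norm_one norm_power)
    moreover have "norm x * norm q ^ j \<le> norm x * 1"
      using assms by (intro mult_left_mono power_le_one) auto
    ultimately show False using assms by simp
  qed
  then show ?thesis by (auto simp: qpoch_def)
qed

lemma qpoch_tendsto:
  assumes "norm q < 1"
  shows "qpoch x q \<longlonglongrightarrow> qpoch_inf x q"
  using has_prod_imp_tendsto'[OF has_prod_qpoch_inf[OF assms, of x]]
  by (simp add: qpoch_def[abs_def])

text \<open>No factor vanishes, and a product convergent in the sense of
  \<open>convergent_prod\<close> is zero only if some factor is.\<close>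

lemma qpoch_inf_nonzero:
  assumes "norm q < 1" "norm x < 1"
  shows "qpoch_inf x q \<noteq> 0"
proof -
  have "1 - x * q ^ j \<noteq> 0" for j
    using qpoch_nonzero[OF assms, of "Suc j"] by (simp add: qpoch_Suc)
  then show ?thesis
    using prodinf_nonzero has_prod_qpoch_inf[OF assms(1), of x]
    unfolding qpoch_inf_def by (metis has_prod_iff)
qed

lemma qpoch_bounded:
  assumes "norm q < 1"
  shows "\<exists>K. \<forall>n. norm (qpoch x q n) \<le> K"
  using convergent_imp_Bseq[OF convergentI[OF qpoch_tendsto[OF assms, of x]]] by (auto simp: Bseq_def)

lemma inverse_qpoch_bounded:
  assumes "norm q < 1" "norm x < 1"
  shows "\<exists>K. \<forall>n. norm (inverse (qpoch x q n)) \<le> K"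
  using convergent_imp_Bseq[OF convergentI[OF tendsto_inverse[OF qpoch_tendsto[OF assms(1), of x]
        qpoch_inf_nonzero[OF assms]]]] by (auto simp: Bseq_def)

section \<open>Reciprocal q-factorials with integer index\<close>

definition rqfact :: "complex \<Rightarrow> int \<Rightarrow> complex" where
  "rqfact q k = (if k < 0 then 0 else inverse (qpoch q q (nat k)))"

text \<open>With the value 0 at negative indices the recurrence holds for every integer, so sums of
  products of such reciprocals range over all integers and have no boundary terms.\<close>

lemma rqfact_of_nat: "rqfact q (int n) = inverse (qpoch q q n)"
  by (simp add: rqfact_def)

lemma rqfact_minus_1:
  assumes "norm q < 1" "q \<noteq> 0"
  shows "rqfact q (k - 1) = (1 - q powi k) * rqfact q k"
proof (cases "k \<le> 0")
  case True
  \<comment> \<open>For \<open>k < 0\<close> both sides are 0. At \<open>k = 0\<close> the left side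
    is 0 and the factor \<open>1 - q powi 0\<close> annihilates the right side.\<close>
  then show ?thesis by (cases "k = 0") (auto simp: rqfact_def)
next
  case False
  define n where "n = nat (k - 1)"
  have k: "k = int (Suc n)" using False by (simp add: n_def)
  have nz: "qpoch q q n \<noteq> 0" "qpoch q q (Suc n) \<noteq> 0"
    using qpoch_nonzero[OF assms(1,1)] by auto
  have p: "q powi k = q * q ^ n" by (simp add: k power_int_def nat_add_distrib)
  have "qpoch q q (Suc n) = qpoch q q n * (1 - q powi k)"
    by (simp add: qpoch_Suc p)
  then have "(1 - q powi k) * inverse (qpoch q q (Suc n)) = inverse (qpoch q q n)"
    using nz by (auto simp: field_simps)
  moreover have "rqfact q k = inverse (qpoch q q (Suc n))" "rqfact q (k - 1) = inverse (qpoch q q n)"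
    using rqfact_of_nat[of q "Suc n"] rqfact_of_nat[of q n] by (simp_all add: k)
  ultimately show ?thesis by simp
qed

lemma rqfact_0 [simp]: "rqfact q 0 = 1"
  by (simp add: rqfact_def)

lemma rqfact_tendsto:
  assumes "norm q < 1"
  shows "(\<lambda>N. rqfact q (int N + r)) \<longlonglongrightarrow> inverse (qpoch_inf q q)"
proof -
  have "(\<lambda>n. inverse (qpoch q q n)) \<longlonglongrightarrow> inverse (qpoch_inf q q)"
    by (intro tendsto_inverse qpoch_tendsto qpoch_inf_nonzero assms)
  moreover have "filterlim (\<lambda>N. nat (int N + r)) at_top at_top"
  proof (rule filterlim_at_top_mono)
    show "filterlim (\<lambda>N. N - nat \<bar>r\<bar>) at_top at_top" by (rule filterlim_minus_const_nat_at_top)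
  qed (auto intro!: always_eventually)
  ultimately have "(\<lambda>N. inverse (qpoch q q (nat (int N + r)))) \<longlonglongrightarrow> inverse (qpoch_inf q q)"
    by (rule filterlim_compose)
  moreover have "\<forall>\<^sub>F N in sequentially. rqfact q (int N + r) = inverse (qpoch q q (nat (int N + r)))"
    using eventually_ge_at_top[of "nat \<bar>r\<bar>"] by eventually_elim (auto simp: rqfact_def)
  ultimately show ?thesis by (simp add: tendsto_cong)
qed

text \<open>A bound uniform in the index provides the constant in the dominating series
  below.\<close>

lemma rqfact_bounded:
  assumes "norm q < 1"
  obtains K where "K > 0" "\<And>k. norm (rqfact q k) \<le> K"
proof -
  obtain K where K: "\<And>n. norm (inverse (qpoch q q n)) \<le> K"
    using inverse_qpoch_bounded[OF assms assms] by auto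
  have "K \<ge> norm (inverse (qpoch q q 0))" by (rule K)
  then show thesis by (intro that[of K]) (use K in \<open>auto simp: rqfact_def\<close>)
qed

section \<open>The Jacobi triple product\<close>

text \<open>The general term of the bilateral theta series. The integer division is exact, since
  \<open>r * (r - 1)\<close> is even.\<close>

definition jterm :: "complex \<Rightarrow> complex \<Rightarrow> int \<Rightarrow> complex" where
  "jterm z q r = (- z) powi r * q powi (r * (r - 1) div 2)"

lemma jterm_plus_1:
  assumes "q \<noteq> 0" "z \<noteq> 0"
  shows "jterm z q (r + 1) = jterm z q r * (- z * q powi r)"
proof -
  have "(r + 1) * (r + 1 - 1) div 2 = r * (r - 1) div 2 + r"
  proof -
    have "(r + 1) * (r + 1 - 1) = r * (r - 1) + r * 2" by (simp add: algebra_simps)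
    then show ?thesis by simp
  qed
  then show ?thesis using assms by (simp add: jterm_def power_int_add)
qed

text \<open>A symmetric form of the finite q-binomial theorem, with support
  \<open>-N <= r <= M\<close>. To raise \<open>N\<close> or \<open>M\<close> by one, the summand is
  combined with its translate by one, which gives a constant multiple of the new summand.\<close>

lemma finite_jacobi_triple_product:
  assumes q: "norm q < 1" "q \<noteq> 0" and z: "z \<noteq> 0"
  shows "((\<lambda>r. jterm z q r * rqfact q (int N + r) * rqfact q (int M - r))
    has_sum (qpoch z q M * qpoch (q / z) q N * rqfact q (int (M + N)))) UNIV"
proof (induction M)
  case 0
  show ?case
  proof (induction N)
    case 0
    have "((\<lambda>r. jterm z q r * rqfact q r * rqfact q (- r))
        has_sum (jterm z q 0 * rqfact q 0 * rqfact q (- 0))) UNIV"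
      by (rule has_sum_int_single) (auto simp: rqfact_def)
    then show ?case by (simp add: jterm_def)
  next
    case (Suc N)
    define h where "h r = jterm z q r * rqfact q (int N + r) * rqfact q (- r)" for r
    define h' where "h' r = jterm z q r * rqfact q (int N + 1 + r) * rqfact q (- r)" for r
    define S where "S = qpoch (q / z) q N * rqfact q (int N)"
    have h: "(h has_sum S) UNIV"
      using Suc by (simp add: h_def[abs_def] S_def)
    then have h1: "((\<lambda>r. h (r + 1)) has_sum S) UNIV" by (simp only: has_sum_int_shift)
    \<comment> \<open>A shift of the index preserves the total \<open>S\<close>, so this combination
      multiplies it by \<open>1 - q ^ Suc N / z\<close>, the factor gained by
      \<open>qpoch (q / z) q\<close>.\<close>
    have A: "((\<lambda>r. h r + (- (q ^ Suc N) / z) * h (r + 1)) has_sum (S + (- (q ^ Suc N) / z) * S)) UNIV"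
      by (intro has_sum_add has_sum_cmult_right h h1)
    have nz: "1 - q powi (int N + 1) \<noteq> 0"
      using qpoch_nonzero[OF q(1,1), of "Suc N"] by (auto simp: qpoch_Suc power_int_def nat_add_distrib)
    have R: "rqfact q (int N + r) = (1 - q powi (int N + 1 + r)) * rqfact q (int N + 1 + r)" for r
      using rqfact_minus_1[OF q, of "int N + 1 + r"] by (simp add: algebra_simps)
    have R': "rqfact q (- r - 1) = (1 - q powi (- r)) * rqfact q (- r)" for r
      using rqfact_minus_1[OF q, of "- r"] by simp
    have "h r + (- (q ^ Suc N) / z) * h (r + 1) = (1 - q powi (int N + 1)) * h' r" for r
    proof -
      define u where "u = q powi r"
      have u: "u \<noteq> 0" using q by (simp add: u_def)
      define v where "v = q ^ Suc N"
      have p: "q powi (int N + 1 + r) = v * u" "q powi (- r) = inverse u" "q powi (int N + 1) = v"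
        using q by (auto simp: v_def u_def power_int_add power_int_minus)
      have h0: "h r = jterm z q r * ((1 - v * u) * rqfact q (int N + 1 + r)) * rqfact q (- r)"
        unfolding h_def R p ..
      have e: "int N + (r + 1) = int N + 1 + r" "- (r + 1) = - r - 1" by simp_all
      have h1: "h (r + 1) = jterm z q r * (- z * u) * rqfact q (int N + 1 + r) * ((1 - inverse u) * rqfact q (- r))"
        unfolding h_def jterm_plus_1[OF q(2) z] e R' p u_def[symmetric] ..
      show ?thesis
        unfolding h0 h1 h'_def p v_def[symmetric]
        using u z by (simp add: field_simps)
    qed
    with A have "((\<lambda>r. (1 - q powi (int N + 1)) * h' r) has_sum (S + (- (q ^ Suc N) / z) * S)) UNIV"
      by simp
    then have "((\<lambda>r. inverse (1 - q powi (int N + 1)) * ((1 - q powi (int N + 1)) * h' r))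
        has_sum (inverse (1 - q powi (int N + 1)) * (S + (- (q ^ Suc N) / z) * S))) UNIV"
      by (rule has_sum_cmult_right)
    moreover have "inverse (1 - q powi (int N + 1)) * (S + (- (q ^ Suc N) / z) * S)
        = qpoch (q / z) q (Suc N) * rqfact q (int N + 1)"
    proof -
      have "S = qpoch (q / z) q N * ((1 - q powi (int N + 1)) * rqfact q (int N + 1))"
        using rqfact_minus_1[OF q, of "int N + 1"] by (simp add: S_def)
      then have "inverse (1 - q powi (int N + 1)) * S = qpoch (q / z) q N * rqfact q (int N + 1)"
        using nz by simp
      then show ?thesis by (simp add: qpoch_Suc algebra_simps)
    qed
    ultimately show ?case using nz by (simp add: h'_def[abs_def] mult.assoc[symmetric] add_ac)
  qed
next
  case (Suc M)
  define h where "h r = jterm z q r * rqfact q (int N + r) * rqfact q (int M - r)" for r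
  define h' where "h' r = jterm z q r * rqfact q (int N + r) * rqfact q (int M + 1 - r)" for r
  define S where "S = qpoch z q M * qpoch (q / z) q N * rqfact q (int (M + N))"
  have h: "(h has_sum S) UNIV"
    using Suc by (simp add: h_def[abs_def] S_def)
  then have h1: "((\<lambda>r. h (r - 1)) has_sum S) UNIV" using has_sum_int_shift[of h "-1"] by simp
  \<comment> \<open>The mirror image for \<open>M\<close>: the shift has the opposite direction and
    the new factor is \<open>1 - z * q ^ M\<close>.\<close>
  have A: "((\<lambda>r. h r + (- z * q ^ M) * h (r - 1)) has_sum (S + (- z * q ^ M) * S)) UNIV"
    by (intro has_sum_add has_sum_cmult_right h h1)
  define c where "c = 1 - q powi (int (M + N) + 1)"
  have nz: "c \<noteq> 0"
    using qpoch_nonzero[OF q(1,1), of "Suc (M + N)"]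
    by (auto simp: c_def qpoch_Suc power_int_def nat_add_distrib)
  have R: "rqfact q (int M - r) = (1 - q powi (int M + 1 - r)) * rqfact q (int M + 1 - r)" for r
    using rqfact_minus_1[OF q, of "int M + 1 - r"] by (simp add: algebra_simps)
  have R': "rqfact q (int N + (r - 1)) = (1 - q powi (int N + r)) * rqfact q (int N + r)" for r
    using rqfact_minus_1[OF q, of "int N + r"] by (simp add: algebra_simps)
  have "h r + (- z * q ^ M) * h (r - 1) = c * h' r" for r
  proof -
    define u where "u = q powi (r - 1)"
    have u: "u \<noteq> 0" using q by (simp add: u_def)
    have r: "r = (r - 1) + 1" by simp
    have p: "q powi (int N + r) = q ^ N * u * q" "q powi (int M + 1 - r) = q ^ M * inverse u"
      using q by (subst r, simp add: u_def power_int_add power_int_minus power_int_diff,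
          simp add: u_def power_int_add power_int_minus power_int_diff field_simps)
    have c: "c = 1 - q ^ M * q ^ N * q"
      using q by (simp add: c_def power_int_add power_add)
    have j: "jterm z q r = jterm z q (r - 1) * (- z * u)"
      using jterm_plus_1[OF q(2) z, of "r - 1"] by (simp add: u_def)
    have e: "int M - (r - 1) = int M + 1 - r" by simp
    show ?thesis
      unfolding h_def h'_def j R R' p c e
      using u z by (simp add: algebra_simps)
  qed
  with A have "((\<lambda>r. c * h' r) has_sum (S + (- z * q ^ M) * S)) UNIV"
    by simp
  then have "((\<lambda>r. inverse c * (c * h' r)) has_sum (inverse c * (S + (- z * q ^ M) * S))) UNIV"
    by (rule has_sum_cmult_right)
  moreover have "inverse c * (S + (- z * q ^ M) * S)
      = qpoch z q (Suc M) * qpoch (q / z) q N * rqfact q (int (M + N) + 1)"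
  proof -
    have "S = qpoch z q M * qpoch (q / z) q N * (c * rqfact q (int (M + N) + 1))"
      using rqfact_minus_1[OF q, of "int (M + N) + 1"] by (simp add: S_def c_def)
    then show ?thesis using nz by (simp add: qpoch_Suc field_simps)
  qed
  ultimately show ?case using nz by (simp add: h'_def[abs_def] mult.assoc[symmetric] add_ac)
qed

text \<open>Consecutive terms have ratio \<open>norm y * norm q ^ n\<close>, which tends to 0
  however large \<open>y\<close> is.\<close>

lemma summable_power_triangular:
  fixes q y :: complex
  assumes q: "norm q < 1"
  shows "summable (\<lambda>n. norm (y ^ n * q ^ (n * (n - 1) div 2)))"
proof -
  have "(\<lambda>n. norm y * norm q ^ n) \<longlonglongrightarrow> norm y * 0"
    using q by (intro tendsto_mult tendsto_const LIMSEQ_power_zero) auto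
  then have "\<forall>\<^sub>F n in sequentially. norm y * norm q ^ n < 1 / 2"
    by (rule order_tendstoD) simp
  then obtain n0 where n0: "\<And>n. n \<ge> n0 \<Longrightarrow> norm y * norm q ^ n < 1 / 2"
    by (auto simp: eventually_at_top_linorder)
  show ?thesis
  proof (rule summable_ratio_test[of "1/2" n0])
    fix n assume n: "n \<ge> n0"
    have e: "Suc n * (Suc n - 1) div 2 = n * (n - 1) div 2 + n"
    proof -
      have "Suc n * (Suc n - 1) = n * (n - 1) + n * 2" by (cases n) (auto simp: algebra_simps)
      then show ?thesis by simp
    qed
    have "norm (y ^ Suc n * q ^ (Suc n * (Suc n - 1) div 2))
        = (norm y * norm q ^ n) * norm (y ^ n * q ^ (n * (n - 1) div 2))"
      unfolding e by (simp add: norm_mult norm_power power_add)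
    also have "\<dots> \<le> 1 / 2 * norm (y ^ n * q ^ (n * (n - 1) div 2))"
      using n0[OF n] by (intro mult_right_mono) auto
    finally show "norm (norm (y ^ Suc n * q ^ (Suc n * (Suc n - 1) div 2)))
        \<le> 1 / 2 * norm (norm (y ^ n * q ^ (n * (n - 1) div 2)))" by simp
  qed auto
qed

lemma jterm_of_nat: "jterm z q (int n) = (- z) ^ n * q ^ (n * (n - 1) div 2)"
proof -
  have "int n * (int n - 1) div 2 = int (n * (n - 1) div 2)"
    by (cases n) (auto simp: zdiv_int algebra_simps)
  then show ?thesis by (simp add: jterm_def)
qed

text \<open>Reflection exchanges \<open>z\<close> and \<open>q / z\<close>, so the negative half of
  a theta series is again a series over the naturals.\<close>

lemma jterm_neg:
  assumes "q \<noteq> 0" "z \<noteq> 0"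
  shows "jterm z q (- r) = jterm (q / z) q r"
proof -
  have "even (r * (r - 1))" by auto
  then have "- r * (- r - 1) div 2 = r + r * (r - 1) div 2"
    by (auto simp: algebra_simps elim!: evenE)
  then show ?thesis
    using assms by (simp add: jterm_def power_int_add power_int_minus power_int_divide_distrib
        power_int_minus_left field_simps)
qed

lemma jterm_abs_summable:
  assumes q: "norm q < 1" "q \<noteq> 0" and z: "z \<noteq> 0"
  shows "(\<lambda>r. norm (jterm z q r)) summable_on UNIV"
proof -
  have nat: "(\<lambda>n. norm (jterm y q (int n))) summable_on UNIV" for y
    using summable_power_triangular[OF q(1), of "- y"]
    by (intro norm_summable_imp_summable_on) (simp add: jterm_of_nat)
  have 1: "(\<lambda>r. norm (jterm z q r)) summable_on range int"
    using nat[of z] by (subst summable_on_reindex) (auto simp: o_def inj_on_def)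
  have "(\<lambda>n. norm (jterm z q (- int n))) summable_on UNIV"
    using nat[of "q / z"] by (simp add: jterm_neg[OF q(2) z])
  then have 2: "(\<lambda>r. norm (jterm z q r)) summable_on range (\<lambda>n. - int n)"
    by (subst summable_on_reindex) (auto simp: o_def inj_on_def)
  have "UNIV = range int \<union> range (\<lambda>n. - int n)"
    by (auto intro: int_cases2)
  then show ?thesis using summable_on_union[OF 1 2] by simp
qed

text \<open>The finite form with \<open>M = N\<close> tending to infinity. Two reciprocal factorials
  on the left and one on the right tend to \<open>inverse (qpoch_inf q q)\<close>, so multiplying by
  the square of \<open>qpoch_inf q q\<close> leaves it once on the right.\<close>

theorem jacobi_triple_product:
  assumes q: "norm q < 1" "q \<noteq> 0" and z: "z \<noteq> 0"
  shows "(jterm z q has_sum (qpoch_inf z q * qpoch_inf (q / z) q * qpoch_inf q q)) UNIV"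
proof -
  obtain K where K: "K > 0" "\<And>k. norm (rqfact q k) \<le> K"
    using rqfact_bounded[OF q(1)] by metis
  let ?P = "qpoch_inf q q"
  have P: "?P \<noteq> 0" using qpoch_inf_nonzero q by simp
  have "((\<lambda>r. jterm z q r * inverse ?P * inverse ?P)
      has_sum (qpoch_inf z q * qpoch_inf (q / z) q * inverse ?P)) UNIV"
  proof (rule has_sum_int_tannery)
    show "(\<lambda>N. jterm z q r * rqfact q (int N + r) * rqfact q (int N - r))
        \<longlonglongrightarrow> jterm z q r * inverse ?P * inverse ?P" for r
      using rqfact_tendsto[OF q(1), of r] rqfact_tendsto[OF q(1), of "- r"]
      by (intro tendsto_intros) auto
    show "norm (jterm z q r * rqfact q (int N + r) * rqfact q (int N - r))
        \<le> norm (jterm z q r) * K * K" for r N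
      unfolding norm_mult using K by (intro mult_mono) auto
    show "(\<lambda>r. norm (jterm z q r) * K * K) summable_on UNIV"
      by (intro summable_on_cmult_left jterm_abs_summable assms)
    show "((\<lambda>r. jterm z q r * rqfact q (int N + r) * rqfact q (int N - r))
       has_sum (qpoch z q N * qpoch (q / z) q N * rqfact q (int (N + N)))) UNIV" for N
      by (rule finite_jacobi_triple_product[OF q z])
    have "(\<lambda>N. rqfact q (int (N + N))) \<longlonglongrightarrow> inverse ?P"
    proof -
      have "filterlim (\<lambda>N. N + N :: nat) at_top at_top"
        by (rule filterlim_at_top_mono[OF filterlim_ident]) (auto intro: always_eventually)
      from filterlim_compose[OF rqfact_tendsto[OF q(1), of 0] this] show ?thesis by simp
    qed
    then show "(\<lambda>N. qpoch z q N * qpoch (q / z) q N * rqfact q (int (N + N)))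
        \<longlonglongrightarrow> qpoch_inf z q * qpoch_inf (q / z) q * inverse ?P"
      by (intro tendsto_intros qpoch_tendsto q)
  qed
  from has_sum_cmult_right[OF this, of "?P * ?P"] show ?thesis
    using P by (simp add: field_simps)
qed

section \<open>A finite form of Bailey's lemma\<close>

text \<open>The q-Vandermonde sum in the form given by Durfee rectangles. The induction step calls
  the hypothesis at \<open>s + 1\<close>, hence the generalization over \<open>s\<close>.\<close>

lemma q_vandermonde_durfee:
  assumes q: "norm q < 1" "q \<noteq> 0"
  shows "((\<lambda>m. q powi (m * (m + s)) * rqfact q m * rqfact q (int M - m) * rqfact q (m + s))
    has_sum (rqfact q (int M) * rqfact q (int M + s))) UNIV"
proof (induction M arbitrary: s)
  case 0
  have "((\<lambda>m. q powi (m * (m + s)) * rqfact q m * rqfact q (- m) * rqfact q (m + s))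
      has_sum (q powi (0 * (0 + s)) * rqfact q 0 * rqfact q (- 0) * rqfact q (0 + s))) UNIV"
    by (rule has_sum_int_single) (auto simp: rqfact_def)
  then show ?case by simp
next
  case (Suc M)
  define G where "G m = q powi (m * (m + (s + 1))) * rqfact q m * rqfact q (int M - m)
    * rqfact q (m + (s + 1))" for m
  \<comment> \<open>A telescoping certificate: \<open>c * F m\<close> equals
    \<open>G m + D (m - 1) - D m\<close>, where \<open>G\<close> is the summand of the induction
    hypothesis at \<open>s + 1\<close>.\<close>
  define D where "D m = q powi ((m + 1) * (m + 1 + s)) * rqfact q m * rqfact q (int M - m)
    * rqfact q (m + 1 + s)" for m
  define F where "F m = q powi (m * (m + s)) * rqfact q m * rqfact q (int M + 1 - m)
    * rqfact q (m + s)" for m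
  define c where "c = 1 - q powi (int M + 1)"
  have c: "c \<noteq> 0"
    using qpoch_nonzero[OF q(1,1), of "Suc M"]
    by (auto simp: c_def qpoch_Suc power_int_def nat_add_distrib)
  have G: "(G has_sum (rqfact q (int M) * rqfact q (int M + (s + 1)))) UNIV"
    using Suc[of "s + 1"] by (simp add: G_def[abs_def])
  \<comment> \<open>\<open>D\<close> has finite support, so it has a total \<open>d\<close>, which
    cancels in the telescoping difference.\<close>
  have "D summable_on {0..int M}" by simp
  then have "D summable_on UNIV"
    by (subst summable_on_cong_neutral[where T = "{0..int M}" and g = D]) (auto simp: D_def rqfact_def)
  then obtain d where D: "(D has_sum d) UNIV" by (auto simp: summable_on_def)
  then have D1: "((\<lambda>m. D (m - 1)) has_sum d) UNIV" using has_sum_int_shift[of D "-1"] by simp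
  have "((\<lambda>m. G m + D (m - 1) + - 1 * D m)
      has_sum (rqfact q (int M) * rqfact q (int M + (s + 1)) + d + - 1 * d)) UNIV"
    by (intro has_sum_add has_sum_cmult_right G D D1)
  moreover have "G m + D (m - 1) + - 1 * D m = c * F m" for m
  proof -
    define u where "u = q powi m"
    define v where "v = q powi (int M + 1 - m)"
    define x where "x = q powi (m * (m + s))"
    define y where "y = q powi (m + s + 1)"
    have 1: "rqfact q (m - 1) = (1 - u) * rqfact q m"
      using rqfact_minus_1[OF q, of m] by (simp add: u_def)
    have 2: "rqfact q (int M - m) = (1 - v) * rqfact q (int M + 1 - m)"
      using rqfact_minus_1[OF q, of "int M + 1 - m"] by (simp add: v_def)
    have 3: "rqfact q (m + s) = (1 - y) * rqfact q (m + s + 1)"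
      using rqfact_minus_1[OF q, of "m + s + 1"] by (simp add: y_def)
    have c': "c = 1 - u * v"
      using q by (simp add: c_def u_def v_def flip: power_int_add)
    have g: "G m = x * u * rqfact q m * ((1 - v) * rqfact q (int M + 1 - m)) * rqfact q (m + s + 1)"
      unfolding G_def 2[symmetric] x_def u_def using q
      by (simp add: algebra_simps flip: power_int_add)
    have d: "D m = x * u * y * rqfact q m * ((1 - v) * rqfact q (int M + 1 - m)) * rqfact q (m + s + 1)"
      unfolding D_def 2[symmetric] x_def u_def y_def using q
      by (simp add: algebra_simps flip: power_int_add)
    have d': "D (m - 1) = x * ((1 - u) * rqfact q m) * rqfact q (int M + 1 - m) * ((1 - y) * rqfact q (m + s + 1))"
      unfolding D_def 1[symmetric] 3[symmetric] x_def using q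
      by (simp add: algebra_simps)
    have f: "F m = x * rqfact q m * rqfact q (int M + 1 - m) * ((1 - y) * rqfact q (m + s + 1))"
      unfolding F_def 3[symmetric] x_def ..
    show ?thesis unfolding g d d' f c' by (simp add: algebra_simps)
  qed
  ultimately have "((\<lambda>m. c * F m) has_sum (rqfact q (int M) * rqfact q (int M + (s + 1)))) UNIV"
    by simp
  then have "((\<lambda>m. inverse c * (c * F m))
      has_sum (inverse c * (rqfact q (int M) * rqfact q (int M + (s + 1))))) UNIV"
    by (rule has_sum_cmult_right)
  moreover have "rqfact q (int M) = c * rqfact q (int M + 1)"
    using rqfact_minus_1[OF q, of "int M + 1"] by (simp add: c_def)
  ultimately show ?case using c by (simp add: F_def[abs_def] mult.assoc[symmetric] add_ac)
qed

text \<open>The q-Vandermonde sum with \<open>s = 2 * r\<close> and \<open>n = m + r\<close>, since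
  \<open>n ^ 2 = r ^ 2 + m * (m + 2 * r)\<close>. For \<open>r > N\<close> both sides
  vanish.\<close>

lemma bailey_sum:
  assumes q: "norm q < 1" "q \<noteq> 0"
  shows "(\<Sum>n\<le>N. q ^ (n ^ 2) * rqfact q (int n - r) * rqfact q (int n + r) * rqfact q (int N - int n))
    = q powi (r ^ 2) * rqfact q (int N - r) * rqfact q (int N + r)"
proof (cases "r \<le> int N")
  case False
  then show ?thesis by (intro trans[OF sum.neutral]) (auto simp: rqfact_def)
next
  case True
  define g where "g n = q powi (n ^ 2) * rqfact q (n - r) * rqfact q (n + r) * rqfact q (int N - n)" for n
  define M where "M = nat (int N - r)"
  have M: "int M = int N - r" using True by (simp add: M_def)
  have "((\<lambda>m. q powi (r ^ 2) * (q powi (m * (m + 2 * r)) * rqfact q m * rqfact q (int M - m)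
        * rqfact q (m + 2 * r)))
      has_sum (q powi (r ^ 2) * (rqfact q (int M) * rqfact q (int M + 2 * r)))) UNIV"
    by (intro has_sum_cmult_right q_vandermonde_durfee q)
  moreover have "q powi (r ^ 2) * (q powi (m * (m + 2 * r)) * rqfact q m * rqfact q (int M - m)
        * rqfact q (m + 2 * r)) = g (m + r)" for m
  proof -
    have "q powi (r ^ 2) * q powi (m * (m + 2 * r)) = q powi ((m + r) ^ 2)"
      using q by (simp add: power2_eq_square algebra_simps flip: power_int_add)
    then show ?thesis by (simp add: g_def M algebra_simps)
  qed
  ultimately have g: "(g has_sum (q powi (r ^ 2) * rqfact q (int N - r) * rqfact q (int N + r))) UNIV"
    by (simp add: has_sum_int_shift M algebra_simps)
  \<comment> \<open>For \<open>n > N\<close> the last factor is 0. For \<open>n < 0\<close> one of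
    \<open>n - r\<close> and \<open>n + r\<close> is negative, as their sum is.\<close>
  have 0: "g n = 0" if "n \<notin> {0..int N}" for n
    using that by (auto simp: g_def rqfact_def)
  have "(g has_sum (q powi (r ^ 2) * rqfact q (int N - r) * rqfact q (int N + r))) {0..int N}"
    using g 0 has_sum_cong_neutral[of UNIV "{0..int N}" g g] by auto
  then have "sum g {0..int N} = q powi (r ^ 2) * rqfact q (int N - r) * rqfact q (int N + r)"
    using has_sum_finite[of "{0..int N}" g] has_sum_unique by blast
  also have "sum g {0..int N} = (\<Sum>n\<le>N. g (int n))"
    by (rule sum.reindex_bij_witness[of _ int nat]) auto
  also have "(\<lambda>n. g (int n)) = (\<lambda>n. q ^ (n ^ 2) * rqfact q (int n - r) * rqfact q (int n + r)
      * rqfact q (int N - int n))"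
    by (simp add: g_def fun_eq_iff flip: power_int_of_nat of_nat_power)
  finally show ?thesis .
qed

text \<open>The limiting case of Bailey's lemma relative to 1 in which both free parameters tend to
  infinity, with the \<open>\<alpha>\<close>-side \<open>c\<close> spread over all integers. A
  version truncated at \<open>N\<close> follows from \<open>bailey_sum\<close>; then
  \<open>N\<close> tends to infinity.\<close>

theorem bailey_lemma_one:
  fixes b :: "nat \<Rightarrow> complex" and c :: "int \<Rightarrow> complex"
  assumes q: "norm q < 1" "q \<noteq> 0"
    and b: "\<And>n. ((\<lambda>r. c r * rqfact q (int n - r) * rqfact q (int n + r)) has_sum b n) UNIV"
    and b_sum: "summable (\<lambda>n. norm (q ^ (n ^ 2) * b n))"
    and c_sum: "(\<lambda>r. norm (q powi (r ^ 2) * c r)) summable_on UNIV"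
  shows "((\<lambda>r. q powi (r ^ 2) * c r) has_sum (qpoch_inf q q * (\<Sum>n. q ^ (n ^ 2) * b n))) UNIV"
proof -
  obtain K where K: "K > 0" "\<And>k. norm (rqfact q k) \<le> K"
    using rqfact_bounded[OF q(1)] by metis
  let ?P = "qpoch_inf q q"
  have P: "?P \<noteq> 0" using qpoch_inf_nonzero q by simp
  define s where "s N = (\<Sum>n\<le>N. q ^ (n ^ 2) * b n * rqfact q (int N - int n))" for N
  have "s \<longlonglongrightarrow> (\<Sum>n. q ^ (n ^ 2) * b n * inverse ?P)"
  proof -
    \<comment> \<open>The factor \<open>rqfact q (int N - int n)\<close> is 0 for
      \<open>n > N\<close>, so the truncation is built into the summand.\<close>
    have s: "s N = (\<Sum>n. q ^ (n ^ 2) * b n * rqfact q (int N - int n))" for N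
      unfolding s_def by (intro suminf_finite[symmetric]) (auto simp: rqfact_def)
    have "(\<lambda>N. q ^ (n ^ 2) * b n * rqfact q (int N - int n)) \<longlonglongrightarrow> q ^ (n ^ 2) * b n * inverse ?P" for n
      using rqfact_tendsto[OF q(1), of "- int n"] by (intro tendsto_intros) auto
    moreover have "norm (q ^ (n ^ 2) * b n * rqfact q (int N - int n)) \<le> norm (q ^ (n ^ 2) * b n) * K" for n N
      unfolding norm_mult using K by (intro mult_left_mono) auto
    ultimately show ?thesis
      using tannerys_theorem[of "\<lambda>n N. q ^ (n ^ 2) * b n * rqfact q (int N - int n)"
          "\<lambda>n. q ^ (n ^ 2) * b n * inverse ?P" sequentially "\<lambda>n. norm (q ^ (n ^ 2) * b n) * K"]
        summable_mult2[OF b_sum, of K]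
      by (simp add: s[abs_def] always_eventually)
  qed
  also have "(\<Sum>n. q ^ (n ^ 2) * b n * inverse ?P) = (\<Sum>n. q ^ (n ^ 2) * b n) * inverse ?P"
    by (intro suminf_mult2[symmetric] summable_norm_cancel[OF b_sum])
  finally have s: "s \<longlonglongrightarrow> (\<Sum>n. q ^ (n ^ 2) * b n) * inverse ?P" .
  have "((\<lambda>r. q powi (r ^ 2) * c r * inverse ?P * inverse ?P)
      has_sum ((\<Sum>n. q ^ (n ^ 2) * b n) * inverse ?P)) UNIV"
  proof (rule has_sum_int_tannery[OF _ _ _ _ s])
    show "(\<lambda>N. q powi (r ^ 2) * c r * rqfact q (int N - r) * rqfact q (int N + r))
        \<longlonglongrightarrow> q powi (r ^ 2) * c r * inverse ?P * inverse ?P" for r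
      using rqfact_tendsto[OF q(1), of r] rqfact_tendsto[OF q(1), of "- r"]
      by (intro tendsto_intros) auto
    show "norm (q powi (r ^ 2) * c r * rqfact q (int N - r) * rqfact q (int N + r))
        \<le> norm (q powi (r ^ 2) * c r) * K * K" for r N
      unfolding norm_mult using K by (intro mult_mono) auto
    show "(\<lambda>r. norm (q powi (r ^ 2) * c r) * K * K) summable_on UNIV"
      by (intro summable_on_cmult_left c_sum)
    show "((\<lambda>r. q powi (r ^ 2) * c r * rqfact q (int N - r) * rqfact q (int N + r)) has_sum s N) UNIV" for N
    proof -
      \<comment> \<open>Exchanging the finite sum over \<open>n\<close> with the sum over
        \<open>r\<close> leaves an inner sum that \<open>bailey_sum\<close> evaluates.\<close>
      have "((\<lambda>r. \<Sum>n\<le>N. (q ^ (n ^ 2) * rqfact q (int N - int n))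
          * (c r * rqfact q (int n - r) * rqfact q (int n + r)))
        has_sum (\<Sum>n\<le>N. (q ^ (n ^ 2) * rqfact q (int N - int n)) * b n)) UNIV"
        by (intro has_sum_finite_sum has_sum_cmult_right b) simp
      moreover have "(\<Sum>n\<le>N. (q ^ (n ^ 2) * rqfact q (int N - int n))
          * (c r * rqfact q (int n - r) * rqfact q (int n + r)))
          = q powi (r ^ 2) * c r * rqfact q (int N - r) * rqfact q (int N + r)" for r
        using arg_cong[OF bailey_sum[OF q, where N = N and r = r], of "\<lambda>x. c r * x"]
        by (simp add: sum_distrib_left mult_ac)
      ultimately show ?thesis by (simp add: s_def mult_ac)
    qed
  qed
  from has_sum_cmult_right[OF this, of "?P * ?P"] show ?thesis
    using P by (simp add: field_simps)
qed

section \<open>The Bailey pair with cubic characters\<close>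

definition chi3 :: "int \<Rightarrow> complex" where
  "chi3 r = (if r mod 3 = 0 then 0 else if r mod 3 = 1 then 1 else -1)"

lemma norm_chi3_le: "norm (chi3 r) \<le> 1"
  by (simp add: chi3_def)

text \<open>\<open>x + 1 / x = 1\<close> factors \<open>1 + t ^ 3\<close>,
  \<open>(- x) ^ 3 = 1\<close> gives period 3, and \<open>x - 1 / x\<close> is a divisor later. The
  witness is \<open>exp (i * pi / 3)\<close>.\<close>

lemma exists_primitive_sixth_root:
  obtains x :: complex where "x \<noteq> 0" "x + 1 / x = 1" "x - 1 / x \<noteq> 0" "(- x) ^ 3 = 1"
proof -
  define x where "x = Complex (1 / 2) (sqrt 3 / 2)"
  have sq: "x * x = x - 1"
    by (simp add: x_def complex_eq_iff)
  have x0: "x \<noteq> 0" by (simp add: x_def complex_eq_iff)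
  have inv: "1 / x = 1 - x" using sq x0 by (simp add: field_simps)
  have "x - 1 / x \<noteq> 0" unfolding inv by (simp add: x_def complex_eq_iff)
  moreover have "x * (x * x) = - 1"
    by (simp only: sq right_diff_distrib) simp
  then have "(- x) ^ 3 = 1" by (simp add: power3_eq_cube mult.assoc)
  ultimately show thesis using that x0 inv by simp
qed

text \<open>With \<open>w = - x\<close>, the difference of \<open>w powi (- r)\<close> and
  \<open>w powi r\<close> is odd and 3-periodic in \<open>r\<close>, hence fixed by its value at
  \<open>r = 1\<close>.\<close>

lemma cube_root_chi3:
  fixes x :: complex
  assumes x: "x \<noteq> 0" "(- x) ^ 3 = 1"
  shows "(- (1 / x)) powi r - (- x) powi r = (x - 1 / x) * chi3 r"
proof -
  define w where "w = - x"
  have w: "w \<noteq> 0" "w powi 3 = 1" using x by (auto simp: w_def)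
  have iw: "w * (w * w) = 1" using w by (simp add: power3_eq_cube mult.assoc)
  then have i: "inverse w = w * w" using w by (simp add: field_simps)
  have a: "- (1 / x) = inverse w" by (simp add: w_def field_simps)
  have b: "w powi r = w powi (r mod 3)"
  proof -
    have "w powi (3 * (r div 3)) = 1" by (simp only: power_int_mult w(2)) simp
    then show ?thesis using power_int_add[of w "3 * (r div 3)" "r mod 3"] w(1) by simp
  qed
  have c: "x - 1 / x = inverse w - w" by (simp add: w_def field_simps)
  have "r mod 3 = 0 \<or> r mod 3 = 1 \<or> r mod 3 = 2" by auto
  then show ?thesis
    unfolding w_def[symmetric] c a power_int_inverse b
    by (auto simp: chi3_def i power2_eq_square iw algebra_simps)
qed

text \<open>Factor by factor, \<open>(1 - x * t) * (1 - t / x) * (1 + t) = 1 + t ^ 3\<close> with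
  \<open>t = q ^ (j + 1)\<close>.\<close>

lemma qpoch_sixth_root_mult:
  assumes "x + 1 / x = (1 :: complex)"
  shows "qpoch (q * x) q m * qpoch (q / x) q m * qpoch (- q) q m = qpoch (- (q ^ 3)) (q ^ 3) m"
proof (induction m)
  case (Suc m)
  define t where "t = q * q ^ m"
  have x: "x \<noteq> 0" using assms by auto
  have "(1 - q * x * q ^ m) * (1 - q / x * q ^ m) = (1 - x * t) * (1 - t / x)"
    by (simp add: t_def mult_ac)
  also have "\<dots> = 1 - (x + 1 / x) * t + t * t"
    using x by (simp add: field_simps)
  finally have "(1 - q * x * q ^ m) * (1 - q / x * q ^ m) * (1 - - q * q ^ m)
      = (1 - t + t * t) * (1 + t)"
    unfolding assms by (simp add: t_def)
  also have "\<dots> = 1 + t ^ 3" by (simp add: power3_eq_cube algebra_simps)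
  also have "\<dots> = 1 - - (q ^ 3) * (q ^ 3) ^ m"
    by (simp add: t_def power_mult_distrib power_mult[symmetric] mult.commute)
  finally have step: "1 - - (q ^ 3) * (q ^ 3) ^ m
      = (1 - q * x * q ^ m) * (1 - q / x * q ^ m) * (1 - - q * q ^ m)" by (rule sym)
  show ?case unfolding qpoch_Suc Suc[symmetric] step by (simp only: mult_ac)
qed simp

text \<open>Comparing the finite triple products at \<open>x\<close> and \<open>1 / x\<close>, where \<open>x\<close> is a primitive
  sixth root of unity, produces the factor \<open>1 - q ^ n\<close>, which vanishes at \<open>n = 0\<close>.\<close>

lemma chi3_bailey_pair:
  assumes q: "norm q < 1" "q \<noteq> 0"
  shows "((\<lambda>r. chi3 r * q powi (r * (r - 1) div 2) * rqfact q (int n - r) * rqfact q (int n + r))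
    has_sum (if n = 0 then 0 else qpoch (- (q ^ 3)) (q ^ 3) (n - 1)
      / (qpoch (- q) q n * qpoch q q (2 * n - 1)))) UNIV"
proof -
  obtain x :: complex where x: "x \<noteq> 0" "x + 1 / x = 1" "x - 1 / x \<noteq> 0" "(- x) ^ 3 = 1"
    by (rule exists_primitive_sixth_root)
  define T where "T y = qpoch y q n * qpoch (q / y) q n" for y
  have T: "((\<lambda>r. jterm y q r * rqfact q (int n + r) * rqfact q (int n - r))
      has_sum (T y * rqfact q (int (n + n)))) UNIV" if "y \<noteq> 0" for y
    using finite_jacobi_triple_product[OF q that, of n n] by (simp add: T_def)
  have "((\<lambda>r. 1 / (x - 1 / x) * (jterm (1 / x) q r * rqfact q (int n + r) * rqfact q (int n - r)
        + - 1 * (jterm x q r * rqfact q (int n + r) * rqfact q (int n - r))))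
      has_sum (1 / (x - 1 / x) * (T (1 / x) * rqfact q (int (n + n)) + - 1 * (T x * rqfact q (int (n + n)))))) UNIV"
    using x by (intro has_sum_cmult_right has_sum_add T) auto
  moreover have "1 / (x - 1 / x) * (jterm (1 / x) q r * rqfact q (int n + r) * rqfact q (int n - r)
        + - 1 * (jterm x q r * rqfact q (int n + r) * rqfact q (int n - r)))
      = chi3 r * q powi (r * (r - 1) div 2) * rqfact q (int n - r) * rqfact q (int n + r)" (is "?l = ?r") for r
  proof -
    have "?l = 1 / (x - 1 / x) * ((- (1 / x)) powi r - (- x) powi r)
        * (q powi (r * (r - 1) div 2) * rqfact q (int n - r) * rqfact q (int n + r))"
      by (simp add: jterm_def algebra_simps)
    also have "1 / (x - 1 / x) * ((- (1 / x)) powi r - (- x) powi r) = chi3 r"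
      unfolding cube_root_chi3[OF x(1,4)] using x(3) by simp
    finally show ?thesis by (simp add: mult_ac)
  qed
  moreover have "1 / (x - 1 / x) * (T (1 / x) * rqfact q (int (n + n)) + - 1 * (T x * rqfact q (int (n + n))))
    = (if n = 0 then 0 else qpoch (- (q ^ 3)) (q ^ 3) (n - 1) / (qpoch (- q) q n * qpoch q q (2 * n - 1)))"
  proof (cases n)
    \<comment> \<open>Every \<open>T y\<close> is 1 here and the difference is 0, whereas the
      quotient formula would give 1 at \<open>n = 0\<close>.\<close>
    case 0
    then show ?thesis by (simp add: T_def)
  next
    case (Suc m)
    \<comment> \<open>Splitting off the first factor of \<open>qpoch y q n\<close> and the last
      factor of \<open>qpoch (q / y) q n\<close> leaves the same \<open>P\<close> for
      \<open>y = x\<close> and \<open>y = 1 / x\<close>.\<close>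
    define P where "P = qpoch (q * x) q m * qpoch (q / x) q m"
    define Q where "Q = q * q ^ m"
    have nz: "qpoch (- q) q m \<noteq> 0" "qpoch q q (Suc (2 * m)) \<noteq> 0"
      "1 + Q \<noteq> 0" "1 - Q \<noteq> 0"
      using qpoch_nonzero[OF q(1), of "-q" "Suc m"] qpoch_nonzero[OF q(1,1), of "Suc m"]
        qpoch_nonzero[OF q(1,1), of "Suc (2 * m)"] q by (auto simp: qpoch_Suc Q_def)
    have T1: "T (1 / x) = (1 - 1 / x) * (1 - Q * x) * P"
      unfolding T_def Suc qpoch_Suc_left[of "1 / x"] qpoch_Suc[of "q / (1 / x)"]
      by (simp add: P_def Q_def mult_ac)
    have T2: "T x = (1 - x) * (1 - Q / x) * P"
      unfolding T_def Suc qpoch_Suc_left[of x] qpoch_Suc[of "q / x"]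
      by (simp add: P_def Q_def mult_ac)
    have "T (1 / x) - T x = (x - 1 / x) * ((1 - Q) * P)"
      unfolding T1 T2 using x(1) by (simp add: field_simps)
    then have "1 / (x - 1 / x) * (T (1 / x) - T x) = (1 - Q) * P"
      using x(3) by simp
    then have "1 / (x - 1 / x) * (T (1 / x) * rqfact q (int (n + n)) + - 1 * (T x * rqfact q (int (n + n))))
        = (1 - Q) * P * rqfact q (int (n + n))"
      by (metis (no_types, lifting) left_diff_distrib mult.assoc mult_minus1 uminus_add_conv_diff
          add.commute)
    \<comment> \<open>With \<open>Q = q ^ n\<close>, the last factor of
      \<open>qpoch q q (2 * n)\<close> is \<open>1 - Q ^ 2\<close>: its part \<open>1 - Q\<close>
      cancels, and \<open>1 + Q\<close> completes \<open>qpoch (- q) q n\<close>.\<close>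
    also have rq: "rqfact q (int (n + n)) = inverse (qpoch q q (Suc (2 * m)) * ((1 - Q) * (1 + Q)))"
    proof -
      have "n + n = Suc (Suc (2 * m))" by (simp add: Suc)
      moreover have "1 - q * q ^ Suc (2 * m) = (1 - Q) * (1 + Q)"
        by (simp add: Q_def algebra_simps power_mult power2_eq_square power_mult_distrib)
      ultimately show ?thesis by (simp only: rqfact_of_nat qpoch_Suc[of q q "Suc (2 * m)"])
    qed
    also have "P = qpoch (- (q ^ 3)) (q ^ 3) m / qpoch (- q) q m"
      using qpoch_sixth_root_mult[OF x(2), of q m] nz by (simp add: P_def field_simps)
    also have "(1 - Q) * (A / B) * inverse (C * ((1 - Q) * (1 + Q))) = A / (B * (1 + Q) * C)"
      if "B \<noteq> 0" "C \<noteq> 0" for A B C :: complex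
      using nz that by (simp add: divide_simps)
    note this[OF nz(1,2)]
    also have "qpoch (- q) q m * (1 + Q) = qpoch (- q) q n"
      by (simp add: Suc qpoch_Suc Q_def)
    finally show ?thesis
      unfolding rq by (simp only:) (simp add: Suc)
  qed
  ultimately show ?thesis by simp
qed

section \<open>Splitting the theta series\<close>

text \<open>Writes theta terms of different bases as signed powers of the same \<open>q\<close>, so
  that they can be compared.\<close>

lemma jterm_power:
  assumes "q \<noteq> 0"
  shows "jterm (s * q ^ a) (q ^ b) r = (- s) powi r * q powi (int a * r + int b * (r * (r - 1) div 2))"
proof -
  have "(q ^ c) powi k = q powi (int c * k)" for c k
    by (simp add: power_int_mult)
  moreover have "- (s * q ^ a) = (- s) * q ^ a" by simp
  ultimately show ?thesis
    unfolding jterm_def using assms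
    by (simp only: power_int_mult_distrib) (simp add: power_int_add mult_ac)
qed

text \<open>Sorts the factors \<open>1 - q ^ k\<close> by the residue of \<open>k\<close> modulo 3
  and passes to the limit along multiples of 3.\<close>

lemma qpoch_inf_trisect:
  assumes q: "norm q < 1"
  shows "qpoch_inf q (q ^ 3) * qpoch_inf (q ^ 2) (q ^ 3) * qpoch_inf (q ^ 3) (q ^ 3) = qpoch_inf q q"
proof -
  have q3: "norm (q ^ 3) < 1" using q by (simp add: norm_power power_less_one_iff)
  have eq: "qpoch q q (3 * n) = qpoch q (q ^ 3) n * qpoch (q ^ 2) (q ^ 3) n * qpoch (q ^ 3) (q ^ 3) n" for n
  proof (induction n)
    case (Suc n)
    have "3 * Suc n = Suc (Suc (Suc (3 * n)))" "q ^ (3 * n) = (q ^ 3) ^ n"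
      by (simp_all add: power_mult)
    then have "qpoch q q (3 * Suc n) = qpoch q q (3 * n) * (1 - q * (q ^ 3) ^ n)
        * (1 - q ^ 2 * (q ^ 3) ^ n) * (1 - q ^ 3 * (q ^ 3) ^ n)"
      by (simp only: qpoch_Suc power_Suc) (simp only: power2_eq_square power3_eq_cube mult_ac)
    then show ?case unfolding Suc qpoch_Suc by (simp only: mult_ac)
  qed simp
  have "(\<lambda>n. qpoch q q (3 * n)) \<longlonglongrightarrow> qpoch_inf q q"
    by (rule filterlim_compose[OF qpoch_tendsto[OF q]])
      (rule filterlim_at_top_mono[OF filterlim_ident], auto intro: always_eventually)
  moreover have "(\<lambda>n. qpoch q q (3 * n))
      \<longlonglongrightarrow> qpoch_inf q (q ^ 3) * qpoch_inf (q ^ 2) (q ^ 3) * qpoch_inf (q ^ 3) (q ^ 3)"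
    unfolding eq by (intro tendsto_intros qpoch_tendsto q3)
  ultimately show ?thesis using LIMSEQ_unique by blast
qed

text \<open>The triple product with base \<open>q ^ 3\<close> at \<open>z = q\<close>, whose three
  products merge by trisection.\<close>

lemma pentagonal_number_theorem:
  assumes q: "norm q < 1" "q \<noteq> 0"
  shows "(jterm q (q ^ 3) has_sum qpoch_inf q q) UNIV"
proof -
  have "norm (q ^ 3) < 1" using q by (simp add: norm_power power_less_one_iff)
  moreover have "q ^ 3 / q = q ^ 2" using q by (simp add: power3_eq_cube power2_eq_square)
  ultimately show ?thesis
    using jacobi_triple_product[of "q ^ 3" q] qpoch_inf_trisect[OF q(1)] q by simp
qed

text \<open>The exponent is \<open>r * (3 * r - 1) / 2\<close>. The coefficient is
  \<open>(-1) ^ n\<close> at \<open>r = 3 * n\<close>, -2 at \<open>6 * n - 1\<close>, 2 at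
  \<open>6 * n - 2\<close> and 0 elsewhere.\<close>

lemma pentagonal_plus_chi3_has_sum:
  assumes q: "norm q < 1" "q \<noteq> 0"
  defines "F \<equiv> (\<lambda>r. ((- 1) powi r + chi3 r) * q powi (r + 3 * (r * (r - 1) div 2)))"
  shows "(F has_sum (qpoch_inf_list [q ^ 12, q ^ 15, q ^ 27] (q ^ 27)
        - 2 * q ^ 2 * qpoch_inf_list [- (q ^ 33), - (q ^ 75), q ^ 108] (q ^ 108)
        + 2 * q ^ 7 * qpoch_inf_list [- (q ^ 15), - (q ^ 93), q ^ 108] (q ^ 108))) UNIV"
    (is "(_ has_sum (?A - 2 * q ^ 2 * ?B + 2 * q ^ 7 * ?C)) _")
proof -
  have qn: "norm (q ^ 27) < 1" "norm (q ^ 108) < 1"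
    using q by (simp_all add: norm_power power_less_one_iff)
  have dv: "q ^ 27 / q ^ 12 = q ^ 15" "q ^ 108 / - (q ^ 33) = - (q ^ 75)" "q ^ 108 / - (q ^ 15) = - (q ^ 93)"
    using q by (simp_all add: field_simps flip: power_add)
  have A: "(jterm (q ^ 12) (q ^ 27) has_sum ?A) UNIV"
    using jacobi_triple_product[of "q ^ 27" "q ^ 12"] q qn dv by (simp add: qpoch_inf_list_def mult_ac)
  have B: "(jterm (- (q ^ 33)) (q ^ 108) has_sum ?B) UNIV"
    using jacobi_triple_product[of "q ^ 108" "- (q ^ 33)"] q qn dv
    by (simp add: qpoch_inf_list_def mult_ac)
  have C: "(jterm (- (q ^ 15)) (q ^ 108) has_sum ?C) UNIV"
    using jacobi_triple_product[of "q ^ 108" "- (q ^ 15)"] q qn dv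
    by (simp add: qpoch_inf_list_def mult_ac)
  have half: "r * (r - 1) div 2 = s" if "2 * s = r * (r - 1)" for r s :: int
    using that[symmetric] by simp
  have F3: "F (3 * n) = jterm (q ^ 12) (q ^ 27) n" for n
  proof -
    define u where "u = n * (n - 1) div 2"
    have u: "2 * u = n * (n - 1)" by (simp add: u_def)
    have "3 * n * (3 * n - 1) div 2 = 9 * u + 3 * n"
      by (rule half) (use u in \<open>simp add: algebra_simps\<close>)
    then have "3 * n + 3 * (3 * n * (3 * n - 1) div 2) = 12 * n + 27 * (n * (n - 1) div 2)"
      by (simp add: u_def[symmetric])
    moreover have "(- 1) powi (3 * n) = ((- 1) powi n :: complex)"
      by (simp add: power_int_mult)
    ultimately show ?thesis
      using jterm_power[OF q(2), of 1 12 27 n] by (simp add: F_def chi3_def)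
  qed
  have m1: "(- 1) powi (6 * n) = (1 :: complex)" for n :: int
    by (simp add: power_int_mult)
  have FB: "F (6 * n - 1) = - 2 * q ^ 2 * jterm (- (q ^ 33)) (q ^ 108) n" for n
  proof -
    define u where "u = n * (n - 1) div 2"
    have u: "2 * u = n * (n - 1)" by (simp add: u_def)
    have "(6 * n - 1) * (6 * n - 1 - 1) div 2 = 36 * u + 9 * n + 1"
      by (rule half) (use u in \<open>simp add: algebra_simps\<close>)
    then have "6 * n - 1 + 3 * ((6 * n - 1) * (6 * n - 1 - 1) div 2) = 2 + (33 * n + 108 * (n * (n - 1) div 2))"
      by (simp add: u_def[symmetric])
    moreover have "chi3 (6 * n - 1) = - 1"
    proof -
      have "(6 * n - 1) mod 3 = 2" by presburger
      then show ?thesis by (simp add: chi3_def)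
    qed
    ultimately have "F (6 * n - 1) = ((- 1) powi (6 * n - 1) + - 1)
        * q powi (2 + (33 * n + 108 * (n * (n - 1) div 2)))"
      by (simp only: F_def)
    also have "(- 1) powi (6 * n - 1) = (- 1 :: complex)"
      by (simp add: power_int_diff m1)
    also have "q powi (2 + (33 * n + 108 * (n * (n - 1) div 2))) = q ^ 2 * jterm (- (q ^ 33)) (q ^ 108) n"
      using jterm_power[OF q(2), of "- 1" 33 108 n] q power_int_add[of q 2] by simp
    finally show ?thesis by simp
  qed
  have FC: "F (6 * n - 2) = 2 * q ^ 7 * jterm (- (q ^ 15)) (q ^ 108) n" for n
  proof -
    define u where "u = n * (n - 1) div 2"
    have u: "2 * u = n * (n - 1)" by (simp add: u_def)
    have "(6 * n - 2) * (6 * n - 2 - 1) div 2 = 36 * u + 3 * n + 3"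
      by (rule half) (use u in \<open>simp add: algebra_simps\<close>)
    then have "6 * n - 2 + 3 * ((6 * n - 2) * (6 * n - 2 - 1) div 2) = 7 + (15 * n + 108 * (n * (n - 1) div 2))"
      by (simp add: u_def[symmetric])
    moreover have "chi3 (6 * n - 2) = 1"
    proof -
      have "(6 * n - 2) mod 3 = 1" by presburger
      then show ?thesis by (simp add: chi3_def)
    qed
    ultimately have "F (6 * n - 2) = ((- 1) powi (6 * n - 2) + 1)
        * q powi (7 + (15 * n + 108 * (n * (n - 1) div 2)))"
      by (simp only: F_def)
    also have "(- 1) powi (6 * n - 2) = (1 :: complex)"
      by (simp add: power_int_diff m1)
    also have "q powi (7 + (15 * n + 108 * (n * (n - 1) div 2))) = q ^ 7 * jterm (- (q ^ 15)) (q ^ 108) n"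
      using jterm_power[OF q(2), of "- 1" 15 108 n] q power_int_add[of q 7] by simp
    finally show ?thesis by simp
  qed
  have 1: "(F has_sum ?A) (range (\<lambda>n. 3 * n))"
    using A by (subst has_sum_reindex) (auto simp: inj_on_def o_def F3)
  have 2: "(F has_sum (- 2 * q ^ 2 * ?B)) (range (\<lambda>n. 6 * n - 1))"
    using has_sum_cmult_right[OF B, of "- 2 * q ^ 2"]
    by (subst has_sum_reindex) (auto simp: inj_on_def o_def FB)
  have 3: "(F has_sum (2 * q ^ 7 * ?C)) (range (\<lambda>n. 6 * n - 2))"
    using has_sum_cmult_right[OF C, of "2 * q ^ 7"]
    by (subst has_sum_reindex) (auto simp: inj_on_def o_def FC)
  have d: "range (\<lambda>n::int. 3 * n) \<inter> range (\<lambda>n. 6 * n - 1) = {}"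
    "(range (\<lambda>n::int. 3 * n) \<union> range (\<lambda>n. 6 * n - 1)) \<inter> range (\<lambda>n. 6 * n - 2) = {}"
    by (auto, presburger+)
  have "(F has_sum (?A + - 2 * q ^ 2 * ?B + 2 * q ^ 7 * ?C))
      (range (\<lambda>n. 3 * n) \<union> range (\<lambda>n. 6 * n - 1) \<union> range (\<lambda>n. 6 * n - 2))" (is "(_ has_sum _) ?U")
    by (intro has_sum_Un_disjoint 1 2 3 d)
  moreover have "F r = 0" if "r \<notin> ?U" for r
  proof -
    have "r mod 3 \<noteq> 0"
    proof
      assume "r mod 3 = 0"
      then have "r = 3 * (r div 3)" by presburger
      then show False using that by blast
    qed
    moreover have "r mod 6 \<noteq> 5"
    proof
      assume "r mod 6 = 5"
      then have "r = 6 * ((r + 1) div 6) - 1" by presburger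
      then show False using that by blast
    qed
    moreover have "r mod 6 \<noteq> 4"
    proof
      assume "r mod 6 = 4"
      then have "r = 6 * ((r + 2) div 6) - 2" by presburger
      then show False using that by blast
    qed
    \<comment> \<open>Only the residues 1 and 2 modulo 6 are left, where sign and character
      cancel.\<close>
    ultimately have "odd r \<and> r mod 3 = 1 \<or> even r \<and> r mod 3 = 2" by presburger
    then show ?thesis by (auto simp: F_def chi3_def power_int_minus_left)
  qed
  ultimately show ?thesis
    using has_sum_cong_neutral[of UNIV ?U F F] by auto
qed

section \<open>Assembly of the series identity\<close>

theorem theorem3p2:
  fixes q :: complex
  assumes "norm q < 1"
  defines "a \<equiv> (\<lambda>n::nat. q ^ (n ^ 2) * qpoch (- (q ^ 3)) (q ^ 3) (n - 1)
                  / (qpoch (- q) q n * qpoch q q (2 * n - 1)))"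
  shows "summable (\<lambda>n. a (Suc n)) \<and>
    1 + (\<Sum>n. a (Suc n)) =
      (qpoch_inf_list [q ^ 12, q ^ 15, q ^ 27] (q ^ 27)
        - 2 * q ^ 2 * qpoch_inf_list [- (q ^ 33), - (q ^ 75), q ^ 108] (q ^ 108)
        + 2 * q ^ 7 * qpoch_inf_list [- (q ^ 15), - (q ^ 93), q ^ 108] (q ^ 108))
      / qpoch_inf q q"
proof (cases "q = 0")
  \<comment> \<open>Negative powers of \<open>q\<close> and the division by \<open>z\<close> in the
    triple product require \<open>q\<close> nonzero; at \<open>q = 0\<close> both sides are
    1.\<close>
  case True
  then show ?thesis by (simp add: a_def qpoch_inf_list_def qpoch_inf_def power_0_left)
next
  case False
  note q = assms(1) False
  let ?P = "qpoch_inf q q"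
  have P: "?P \<noteq> 0" using qpoch_inf_nonzero q by simp
  \<comment> \<open>\<open>b 0\<close> is 0 as in the Bailey pair; the summand 1 of the identity
    comes from the pentagonal series instead.\<close>
  define b where "b n = (if n = 0 then 0 else qpoch (- (q ^ 3)) (q ^ 3) (n - 1)
      / (qpoch (- q) q n * qpoch q q (2 * n - 1)))" for n
  have ab: "q ^ (Suc n ^ 2) * b (Suc n) = a (Suc n)" for n by (simp add: a_def b_def)
  have "norm (q ^ 3) < 1" using q by (simp add: norm_power power_less_one_iff)
  then obtain K1 where K1: "\<And>n. norm (qpoch (- (q ^ 3)) (q ^ 3) n) \<le> K1"
    using qpoch_bounded by metis
  obtain K2 where K2: "\<And>n. norm (inverse (qpoch (- q) q n)) \<le> K2"
    using inverse_qpoch_bounded[OF q(1), of "- q"] q by auto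
  obtain K3 where K3: "\<And>n. norm (inverse (qpoch q q n)) \<le> K3"
    using inverse_qpoch_bounded[OF q(1,1)] by auto
  have K: "0 \<le> K1" "0 \<le> K2" "0 \<le> K3"
    using K1[of 0] K2[of 0] K3[of 0] norm_ge_zero order_trans by blast+
  have "summable (\<lambda>n. norm (a (Suc n)))"
  proof (rule summable_comparison_test')
    \<comment> \<open>The Pochhammer quotients are uniformly bounded, so the decay of
      \<open>q ^ (Suc n ^ 2)\<close> alone gives a geometric majorant.\<close>
    show "summable (\<lambda>n. norm q ^ n * (K1 * (K2 * K3)))"
      using q by (intro summable_mult2 summable_geometric) simp
    fix n :: nat
    have "a (Suc n) = q ^ (Suc n ^ 2) * (qpoch (- (q ^ 3)) (q ^ 3) n * (inverse (qpoch (- q) q (Suc n))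
        * inverse (qpoch q q (2 * Suc n - 1))))"
      by (simp add: a_def divide_inverse)
    moreover have "norm (q ^ (Suc n ^ 2)) \<le> norm q ^ n"
      unfolding norm_power using q by (intro power_decreasing) (auto simp: power2_eq_square)
    ultimately have "norm (a (Suc n)) \<le> norm q ^ n * (K1 * (K2 * K3))"
      by (simp only: norm_mult) (intro mult_mono mult_nonneg_nonneg norm_ge_zero zero_le_power K K1 K2 K3)
    then show "norm (norm (a (Suc n))) \<le> norm q ^ n * (K1 * (K2 * K3))" by simp
  qed
  then have suma: "summable (\<lambda>n. norm (q ^ (Suc n ^ 2) * b (Suc n)))" by (simp only: ab)
  then have sumb: "summable (\<lambda>n. norm (q ^ (n ^ 2) * b n))"
    using summable_Suc_iff[of "\<lambda>n. norm (q ^ (n ^ 2) * b n)"] by blast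
  have sum_ab: "(\<Sum>n. q ^ (n ^ 2) * b n) = (\<Sum>n. a (Suc n))"
    using suminf_split_head[OF summable_norm_cancel[OF sumb]] by (simp only: ab) (simp add: b_def)
  \<comment> \<open>The factor \<open>q powi (r ^ 2)\<close> from Bailey's lemma turns the
    \<open>\<alpha>\<close>-side exponent into the pentagonal one.\<close>
  have exponent: "q powi (r ^ 2) * q powi (r * (r - 1) div 2)
      = q powi (r + 3 * (r * (r - 1) div 2))" for r
  proof -
    define u where "u = r * (r - 1) div 2"
    have "2 * u = r * (r - 1)" by (simp add: u_def)
    then have "r ^ 2 + u = r + 3 * u"
      by (simp add: power2_eq_square algebra_simps)
    then have "r ^ 2 + r * (r - 1) div 2 = r + 3 * (r * (r - 1) div 2)"
      by (simp only: u_def)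
    then show ?thesis using q(2) by (metis power_int_add)
  qed
  have j: "jterm q (q ^ 3) r = (- 1) powi r * q powi (r + 3 * (r * (r - 1) div 2))" for r
    using jterm_power[OF q(2), of 1 1 3 r] by simp
  have "((\<lambda>r. q powi (r ^ 2) * (chi3 r * q powi (r * (r - 1) div 2)))
      has_sum (?P * (\<Sum>n. q ^ (n ^ 2) * b n))) UNIV"
  proof (rule bailey_lemma_one[OF q _ sumb])
    show "((\<lambda>r. chi3 r * q powi (r * (r - 1) div 2) * rqfact q (int n - r) * rqfact q (int n + r))
        has_sum b n) UNIV" for n
      unfolding b_def by (rule chi3_bailey_pair[OF q])
    \<comment> \<open>The pentagonal series dominates, its exponents being the same and
      \<open>chi3\<close> being bounded by 1.\<close>
    have "(\<lambda>r. norm (jterm q (q ^ 3) r)) summable_on UNIV"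
      using q by (intro jterm_abs_summable) (simp_all add: norm_power power_less_one_iff)
    then show "(\<lambda>r. norm (q powi (r ^ 2) * (chi3 r * q powi (r * (r - 1) div 2)))) summable_on UNIV"
    proof (rule Infinite_Sum.abs_summable_on_comparison_test')
      fix r
      have "norm (q powi (r ^ 2) * (chi3 r * q powi (r * (r - 1) div 2)))
          = norm (chi3 r) * norm (q powi (r + 3 * (r * (r - 1) div 2)))"
        unfolding exponent[symmetric] by (simp add: norm_mult)
      also have "\<dots> \<le> 1 * norm (q powi (r + 3 * (r * (r - 1) div 2)))"
        by (intro mult_right_mono norm_chi3_le) simp
      also have "\<dots> = norm (jterm q (q ^ 3) r)"
        by (simp add: j norm_mult norm_power_int)
      finally show "norm (q powi (r ^ 2) * (chi3 r * q powi (r * (r - 1) div 2)))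
          \<le> norm (jterm q (q ^ 3) r)" .
    qed
  qed
  then have "((\<lambda>r. jterm q (q ^ 3) r + q powi (r ^ 2) * (chi3 r * q powi (r * (r - 1) div 2)))
      has_sum (?P + ?P * (\<Sum>n. a (Suc n)))) UNIV"
    unfolding sum_ab by (rule has_sum_add[OF pentagonal_number_theorem[OF q]])
  moreover have "jterm q (q ^ 3) r + q powi (r ^ 2) * (chi3 r * q powi (r * (r - 1) div 2))
      = ((- 1) powi r + chi3 r) * q powi (r + 3 * (r * (r - 1) div 2))" for r
    by (simp only: j mult.left_commute[of _ "chi3 r"] exponent distrib_right)
  ultimately have "((\<lambda>r. ((- 1) powi r + chi3 r) * q powi (r + 3 * (r * (r - 1) div 2)))
      has_sum (?P + ?P * (\<Sum>n. a (Suc n)))) UNIV"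
    by (simp only:)
  \<comment> \<open>Two evaluations of one bilateral series: by Bailey's lemma plus the pentagonal
    theorem, and by residue classes.\<close>
  note has_sum_unique[OF this pentagonal_plus_chi3_has_sum[OF q]]
  then have "(1 + (\<Sum>n. a (Suc n))) * ?P = qpoch_inf_list [q ^ 12, q ^ 15, q ^ 27] (q ^ 27)
        - 2 * q ^ 2 * qpoch_inf_list [- (q ^ 33), - (q ^ 75), q ^ 108] (q ^ 108)
        + 2 * q ^ 7 * qpoch_inf_list [- (q ^ 15), - (q ^ 93), q ^ 108] (q ^ 108)"
    by (subst distrib_right) (simp only: mult_1_left mult.commute)
  moreover have "summable (\<lambda>n. a (Suc n))"
    using summable_norm_cancel[OF suma] by (simp only: ab)
  ultimately show ?thesis unfolding nonzero_eq_divide_eq[OF P] by (rule conjI[rotated])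
qed

end
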